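(* Let $Q$ be a real field and let $f \in Q[X]$ be irreducible of odd degree. If $f$ has a root $\alpha$ that lies in some real repeated radical extension of $Q$, then $\alpha$ is the only real root of $f$.
   Context: A real field is a subfield of the real numbers $\mathbb{R}$. A field extension $F \subseteq L$ is a radical extension if $L = F[\alpha]$ for some $\alpha \in L$ with $\alpha^n \in F$ for some positive integer $n$. An extension $F \subseteq L$ is a repeated radical extension if there are intermediate fields $F = L_0 \subseteq L_1 \subseteq \cdots \subseteq L_r = L$ such that $L_i$ is a radical extension of $L_{i-1}$ for $0 < i \le r$. A real repeated radical extension of $Q$ is a repeated radical extension $L$ of $Q$ with $L \subseteq \mathbb{R}$. *)

theory Defs
  imports Complex_Main "HOL-Algebra.Algebraic_Closure_Type"
begin

abbreviation real_ring :: "real ring" where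
  "real_ring \<equiv> ring_of_type_algebra"

text \<open>
  Field extensions are pairs of subfields of an ambient ring. The set
  \<open>simple_extension F a\<close> is the ring adjunction $F[a]$, that is, all polynomial
  expressions in $a$ with coefficients in $F$ (in Horner form).
\<close>

definition (in ring) radical_extension :: "'a set \<Rightarrow> 'a set \<Rightarrow> bool" where
  "radical_extension F L \<longleftrightarrow>
     subfield F R \<and> subfield L R \<and> F \<subseteq> L \<and>
     (\<exists>a\<in>L. L = simple_extension F a \<and> (\<exists>n::nat. n > 0 \<and> a [^] n \<in> F))"

text \<open>A tower of length zero is allowed, so every subfield is a repeated radical extension of itself.\<close>

definition (in ring) repeated_radical_extension :: "'a set \<Rightarrow> 'a set \<Rightarrow> bool" where
  "repeated_radical_extension F L \<longleftrightarrow>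
     (\<exists>(r::nat) (E::nat \<Rightarrow> 'a set).
        E 0 = F \<and> E r = L \<and> (\<forall>i\<le>r. subfield (E i) R) \<and>
        (\<forall>i. 0 < i \<and> i \<le> r \<longrightarrow> radical_extension (E (i - 1)) (E i)))"

end

theory Submission
  imports Defs
begin

text \<open>
  Let \<open>A\<close> be the set of real roots of \<open>f\<close>. The proof follows one property of a field \<open>K\<close> up
  the tower: the elements of \<open>A\<close> are conjugate over \<open>K\<close>, that is, a polynomial over \<open>K\<close> that
  vanishes at one of them vanishes at all of them. Over $Q$ this is the irreducibility of \<open>f\<close>.
  Over a field that contains \<open>\<alpha>\<close> it says that $X - \alpha$ vanishes on all of \<open>A\<close>, so
  $A = \{\alpha\}$.

  It remains to pass from \<open>K\<close> to $K[a]$, where $a^n \in K$ (\<open>conjugate_over_radical_step\<close>). Let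
  \<open>\<alpha>\<close> and \<open>\<beta>\<close> be in \<open>A\<close> and let \<open>m > 0\<close> be minimal with $a^m \in K[\alpha]$, say
  $a^m = u(\alpha)$ with $u \in K[X]$. Two facts, both about real radicals, do the work.

  First, $u(\beta) = u(\alpha)$ (\<open>radical_values_agree\<close>). Some power $u(\alpha)^k$ lies in \<open>K\<close>.
  The degree of \<open>\<alpha>\<close> over \<open>K\<close> is odd, so an element of $K[\alpha]$ whose square lies in
  \<open>K\<close> lies in \<open>K\<close> itself, and therefore the least such \<open>k\<close> is odd. Conjugacy gives
  $u(\beta)^k = u(\alpha)^k$, and odd roots of real numbers are unique.

  Second, $1, a, \dots, a^{m-1}$ are linearly independent over the real field $K[\alpha]$
  (\<open>radical_powers_independent\<close>): all complex roots of a proper factor of $X^m - a^m$ have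
  absolute value $|a|$, so the constant term would put a smaller power of \<open>a\<close> into $K[\alpha]$.

  Every value $p(\alpha)$ with $p \in K[a][X]$ can be rewritten as $\sum_{j<m} h_j(\alpha) a^j$ with
  $h_j \in K[X]$, using only $a^m = u(\alpha)$. By the first fact the same rewriting is
  valid for $p(\beta)$. If $p(\alpha) = 0$, all $h_j(\alpha)$ vanish by the second fact, hence all
  $h_j(\beta)$ vanish by conjugacy over \<open>K\<close>, hence $p(\beta) = 0$.
\<close>

section \<open>Polynomials over a subfield of the reals\<close>

text \<open>
  Polynomials over a subfield are type-level real polynomials with restricted coefficients, so that
  division, degrees and evaluation are those of \<open>real poly\<close>. The list polynomials of the
  algebraic structure \<open>real_ring\<close> enter only through irreducibility over $Q$ and the fact
  that adjoining a root gives a field.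
\<close>

definition poly_over :: "real set \<Rightarrow> real poly \<Rightarrow> bool" where
  "poly_over K p \<longleftrightarrow> (\<forall>i. Polynomial.coeff p i \<in> K)"

lemma field_real_ring: "field real_ring"
  by (rule field_from_type_algebra)

lemma real_ring_ops [simp]:
  "carrier real_ring = UNIV" "\<zero>\<^bsub>real_ring\<^esub> = 0" "\<one>\<^bsub>real_ring\<^esub> = 1"
  "x \<oplus>\<^bsub>real_ring\<^esub> y = x + y" "x \<otimes>\<^bsub>real_ring\<^esub> y = x * y"
  by (simp_all add: ring_of_type_algebra_def)

lemma real_ring_power [simp]: "x [^]\<^bsub>real_ring\<^esub> (n::nat) = x ^ n"
  by (induction n) (simp_all add: nat_pow_def)

lemma subfield_real_ring_closed:
  assumes "subfield K real_ring"
  shows "0 \<in> K" "1 \<in> K" "x \<in> K \<Longrightarrow> y \<in> K \<Longrightarrow> x + y \<in> K"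
    "x \<in> K \<Longrightarrow> y \<in> K \<Longrightarrow> x * y \<in> K" "x \<in> K \<Longrightarrow> - x \<in> K"
    "x \<in> K \<Longrightarrow> y \<in> K \<Longrightarrow> x - y \<in> K" "x \<in> K \<Longrightarrow> y \<in> K \<Longrightarrow> x / y \<in> K"
    "x \<in> K \<Longrightarrow> x ^ n \<in> K"
proof -
  interpret R: field real_ring by (rule field_real_ring)
  note sub = subfieldE(1)[OF assms]
  note S = subringE[OF sub, simplified]
  show zero: "0 \<in> K" and one: "1 \<in> K" using S by auto
  show add: "x + y \<in> K" if "x \<in> K" "y \<in> K" for x y using S that by auto
  show mult: "x * y \<in> K" if "x \<in> K" "y \<in> K" for x y using S that by auto
  have neg: "- x \<in> K" if "x \<in> K" for x
  proof -
    have "\<ominus>\<^bsub>real_ring\<^esub> x \<in> K" using subringE(5)[OF sub that] .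
    moreover have "\<ominus>\<^bsub>real_ring\<^esub> x = - x"
      by (rule R.minus_equality) auto
    ultimately show ?thesis by simp
  qed
  show "- x \<in> K" if "x \<in> K" using neg[OF that] .
  show "x - y \<in> K" if "x \<in> K" "y \<in> K" using add[OF that(1) neg[OF that(2)]] by simp
  show "x / y \<in> K" if x: "x \<in> K" and y: "y \<in> K"
  proof (cases "y = 0")
    case False
    have i: "inv\<^bsub>real_ring\<^esub> y \<in> K" "y \<otimes>\<^bsub>real_ring\<^esub> inv\<^bsub>real_ring\<^esub> y = \<one>\<^bsub>real_ring\<^esub>"
      using R.subfield_m_inv[OF assms, of y] y False by auto
    then have "inv\<^bsub>real_ring\<^esub> y = 1 / y" using False by (simp add: field_simps)
    then show ?thesis using mult[OF x i(1)] by simp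
  qed (use zero in simp)
  show "x ^ n \<in> K" if "x \<in> K" using that by (induction n) (auto intro: one mult)
qed

lemma poly_over_pCons [simp]: "poly_over K (pCons a p) \<longleftrightarrow> a \<in> K \<and> poly_over K p"
proof
  assume *: "poly_over K (pCons a p)"
  have "Polynomial.coeff (pCons a p) 0 \<in> K" "Polynomial.coeff (pCons a p) (Suc i) \<in> K" for i
    using * unfolding poly_over_def by blast+
  then show "a \<in> K \<and> poly_over K p" by (simp add: poly_over_def)
next
  assume "a \<in> K \<and> poly_over K p"
  then show "poly_over K (pCons a p)"
    by (auto simp: poly_over_def coeff_pCons split: nat.splits)
qed

lemma poly_over_arith:
  assumes "subfield K real_ring"
  shows "poly_over K 0" "c \<in> K \<Longrightarrow> poly_over K p \<Longrightarrow> poly_over K (smult c p)"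
    "poly_over K p \<Longrightarrow> poly_over K q \<Longrightarrow> poly_over K (p + q)"
    "poly_over K p \<Longrightarrow> poly_over K q \<Longrightarrow> poly_over K (p - q)"
    "poly_over K p \<Longrightarrow> poly_over K q \<Longrightarrow> poly_over K (p * q)"
    "poly_over K p \<Longrightarrow> poly_over K (p ^ n)"
proof -
  note cl = subfield_real_ring_closed[OF assms]
  show zero: "poly_over K 0" using cl by (simp add: poly_over_def)
  show smult: "poly_over K (smult c p)" if "c \<in> K" "poly_over K p" for c p
    using cl that by (simp add: poly_over_def)
  show add: "poly_over K (p + q)" if "poly_over K p" "poly_over K q" for p q
    using cl that by (simp add: poly_over_def)
  show "poly_over K (p - q)" if "poly_over K p" "poly_over K q"
    using cl that by (simp add: poly_over_def)
  show mult: "poly_over K (p * q)" if "poly_over K p" "poly_over K q" for p q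
    using that(1) that cl(1) by (induction p) (auto simp: zero add smult)
  show "poly_over K (p ^ n)" if "poly_over K p"
    using that cl(1,2) zero by (induction n) (auto simp: mult one_pCons)
qed

lemma poly_over_div_mod:
  assumes "subfield K real_ring" "poly_over K p" "poly_over K q"
  shows "poly_over K (p div q)" "poly_over K (p mod q)"
proof -
  note cl = subfield_real_ring_closed[OF assms(1)]
  note ar = poly_over_arith[OF assms(1)]
  have "poly_over K (p div q) \<and> poly_over K (p mod q)"
    using assms(2)
  proof (induction p)
    case (pCons a p)
    then have IH: "poly_over K (p div q)" "poly_over K (p mod q)" and a: "a \<in> K" by auto
    have "poly_over K (pCons a (p mod q))" using IH a by simp
    then have "Polynomial.coeff (pCons a (p mod q)) (Polynomial.degree q) / lead_coeff q \<in> K"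
      using assms(3) by (intro cl) (simp_all add: poly_over_def)
    then show ?case
      using IH a assms(3) pCons.prems by (auto simp: div_pCons_eq mod_pCons ar Let_def)
  qed (simp add: ar)
  then show "poly_over K (p div q)" "poly_over K (p mod q)" by auto
qed

lemma poly_over_mono: "poly_over K p \<Longrightarrow> K \<subseteq> L \<Longrightarrow> poly_over L p"
  by (auto simp: poly_over_def)

lemma simple_extension_eq_poly_values:
  assumes "subfield K real_ring"
  shows "ring.simple_extension real_ring K a = {poly p a |p. poly_over K p}"
proof -
  interpret R: field real_ring by (rule field_real_ring)
  note z = poly_over_arith(1)[OF assms]
  show ?thesis
  proof (intro equalityI subsetI)
    fix x assume "x \<in> R.simple_extension K a"
    then show "x \<in> {poly p a |p. poly_over K p}"
    proof (induction rule: R.simple_extension.induct)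
      case zero
      show ?case using z by (auto intro!: exI[of _ 0])
    next
      case (lin k1 k2)
      then obtain p where p: "poly_over K p" "k1 = poly p a" by auto
      then show ?case using lin(2) by (auto intro!: exI[of _ "pCons k2 p"])
    qed
  next
    fix x assume "x \<in> {poly p a |p. poly_over K p}"
    then obtain p where p: "poly_over K p" "x = poly p a" by auto
    from p(1) have "poly p a \<in> R.simple_extension K a"
    proof (induction p)
      case 0
      then show ?case using R.simple_extension.zero[of K a] by simp
    next
      case (pCons k p)
      have "(poly p a \<otimes>\<^bsub>real_ring\<^esub> a) \<oplus>\<^bsub>real_ring\<^esub> k \<in> R.simple_extension K a"
        by (rule R.simple_extension.lin) (use pCons in auto)
      then show ?case by (simp add: algebra_simps)
    qed
    then show "x \<in> R.simple_extension K a" using p by simp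
  qed
qed

section \<open>Powers of a real radical\<close>

text \<open>
  The constant term is, up to sign and the leading coefficient, the product of the roots.
\<close>

lemma norm_coeff_0_eq_roots_norm:
  fixes p :: "complex poly"
  assumes "\<And>z. poly p z = 0 \<Longrightarrow> norm z = r"
  shows "norm (Polynomial.coeff p 0) = norm (lead_coeff p) * r ^ Polynomial.degree p"
  using assms
proof (induction "Polynomial.degree p" arbitrary: p)
  case 0
  then show ?case by simp
next
  case (Suc n)
  then obtain z where z: "poly p z = 0"
    using fundamental_theorem_of_algebra[of p] by (metis constant_degree nat.distinct(1))
  then obtain q where q: "p = [:- z, 1:] * q" by (auto simp: poly_eq_0_iff_dvd)
  have "q \<noteq> 0" using Suc(2) q by auto
  have dp: "Polynomial.degree p = Suc (Polynomial.degree q)"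
    unfolding q using \<open>q \<noteq> 0\<close> by (subst degree_mult_eq) auto
  have "norm (Polynomial.coeff q 0) = norm (lead_coeff q) * r ^ Polynomial.degree q"
    using Suc(1)[of q] Suc(2) dp Suc(3) q by auto
  moreover have "norm z = r" using Suc(3) z by blast
  moreover have "lead_coeff p = lead_coeff q" unfolding q by (subst lead_coeff_mult) simp
  moreover have "Polynomial.coeff p 0 = - z * Polynomial.coeff q 0" unfolding q by (simp add: coeff_mult)
  ultimately show ?case using dp by (simp add: norm_mult algebra_simps)
qed

lemma minimal_poly_over_exists:
  assumes K: "subfield K real_ring" and p: "poly_over K p" "p \<noteq> 0" "poly p a = 0"
  obtains q where "poly_over K q" "q \<noteq> 0" "poly q a = 0" "Polynomial.degree q \<le> Polynomial.degree p"
    "\<And>p'. poly_over K p' \<Longrightarrow> poly p' a = 0 \<Longrightarrow> q dvd p'"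
proof -
  let ?P = "\<lambda>q. poly_over K q \<and> q \<noteq> 0 \<and> poly q a = 0"
  obtain q where q: "?P q" and least: "\<And>r. ?P r \<Longrightarrow> Polynomial.degree q \<le> Polynomial.degree r"
    using ex_has_least_nat[of ?P p Polynomial.degree] p by blast
  have "q dvd p'" if "poly_over K p'" "poly p' a = 0" for p'
  proof (rule ccontr)
    assume "\<not> q dvd p'"
    then have nz: "p' mod q \<noteq> 0" by (simp add: dvd_eq_mod_eq_0)
    have "poly (p' mod q) a = 0"
      using arg_cong[OF div_mult_mod_eq[of p' q], of "\<lambda>t. poly t a"] q that
      unfolding poly_add poly_mult by simp
    then have "?P (p' mod q)" using nz poly_over_div_mod[OF K] that q by auto
    from least[OF this] show False
      using degree_mod_less[of q p'] q nz by auto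
  qed
  then show ?thesis using that[of q] q least p by blast
qed

text \<open>
  This is the irreducibility of $X^m - a^m$ over a real field that contains no smaller power of
  \<open>a\<close>. The minimal polynomial \<open>q\<close> of \<open>a\<close> divides $X^m - a^m$, whose complex roots
  all have absolute value $|a|$. Comparing constant terms, $|a|^d$ is in \<open>K\<close> for
  $d = \deg q$. Since \<open>a\<close> is real, this is $a^d$ up to sign, so that $d \ge m$.
\<close>

lemma radical_powers_independent:
  assumes K: "subfield K real_ring" and m: "a ^ m \<in> K" "m > 0" and min: "\<And>j. 0 < j \<Longrightarrow> j < m \<Longrightarrow> a ^ j \<notin> K"
    and p: "poly_over K p" "Polynomial.degree p < m" "poly p a = 0"
  shows "p = 0"
proof (rule ccontr)
  assume "p \<noteq> 0"
  note cl = subfield_real_ring_closed[OF K]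
  obtain q where q: "poly_over K q" "q \<noteq> 0" "poly q a = 0" "Polynomial.degree q \<le> Polynomial.degree p"
    and dvd: "\<And>p'. poly_over K p' \<Longrightarrow> poly p' a = 0 \<Longrightarrow> q dvd p'"
    using minimal_poly_over_exists[OF K p(1) \<open>p \<noteq> 0\<close> p(3)] by blast
  let ?b = "Polynomial.monom 1 m - [:a ^ m:]"
  have "poly_over K ?b" using cl m by (auto simp: poly_over_def coeff_pCons split: nat.splits)
  then have "q dvd ?b" by (intro dvd) (simp_all add: poly_monom)
  then obtain s where s: "?b = q * s" by auto
  let ?q = "map_poly complex_of_real q"
  have "norm z = \<bar>a\<bar>" if "poly ?q z = 0" for z
  proof -
    have "map_poly complex_of_real ?b = ?q * map_poly complex_of_real s"
      unfolding s by (rule poly_eqI) (simp add: coeff_map_poly coeff_mult)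
    then have "poly (map_poly complex_of_real ?b) z = 0" using that by simp
    moreover have "map_poly complex_of_real ?b = Polynomial.monom 1 m - [:of_real (a ^ m):]"
      by (rule poly_eqI) (simp add: coeff_map_poly coeff_pCons split: nat.split)
    ultimately have "z ^ m = of_real (a ^ m)" by (simp add: poly_monom)
    then have "norm z ^ m = \<bar>a\<bar> ^ m"
      by (metis norm_of_real norm_power power_abs)
    then show ?thesis using m by (simp add: power_eq_iff_eq_base)
  qed
  from norm_coeff_0_eq_roots_norm[of ?q, OF this]
  have "\<bar>Polynomial.coeff q 0\<bar> = \<bar>lead_coeff q\<bar> * \<bar>a\<bar> ^ Polynomial.degree q"
    by (simp add: coeff_map_poly degree_map_poly)
  then have "\<bar>a ^ Polynomial.degree q\<bar> = \<bar>Polynomial.coeff q 0 / lead_coeff q\<bar>"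
    using q by (simp add: field_simps power_abs)
  moreover have "Polynomial.coeff q 0 / lead_coeff q \<in> K" using q by (intro cl) (simp_all add: poly_over_def)
  ultimately have "a ^ Polynomial.degree q \<in> K"
    using cl(5) by (metis abs_eq_iff)
  moreover have "Polynomial.degree q > 0" using q
    by (metis degree_eq_zeroE gr_zeroI poly_const_conv pCons_0_0)
  ultimately show False using min q p by auto
qed

section \<open>Square roots in extensions of odd degree\<close>

text \<open>
  An element of \<open>K\<close> that becomes a square modulo a polynomial \<open>p\<close> of odd degree is a
  square in \<open>K\<close>. The proof is a descent on the degree of \<open>p\<close>. Reduce \<open>v\<close> to its
  remainder \<open>r\<close>; if \<open>r\<close> is not constant, then $r^2 - e$ has even degree, less than
  $2 \deg p$, so the cofactor of \<open>p\<close> in it has odd degree less than $\deg p$ and can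
  replace \<open>p\<close>.
\<close>

lemma square_mod_odd_degree:
  assumes K: "subfield K real_ring" and p: "poly_over K p" "odd (Polynomial.degree p)"
    and v: "poly_over K v" and e: "e \<in> K" and dvd: "p dvd v\<^sup>2 - [:e:]"
  shows "\<exists>w\<in>K. w\<^sup>2 = e"
  using p v dvd
proof (induction "Polynomial.degree p" arbitrary: p v rule: less_induct)
  case less
  note ar = poly_over_arith[OF K] and cl = subfield_real_ring_closed[OF K]
  define r where "r = v mod p"
  have p0: "p \<noteq> 0" "Polynomial.degree p > 0" using less.prems(2) by (auto elim: oddE)
  have r: "poly_over K r" unfolding r_def using poly_over_div_mod[OF K] less.prems by auto
  have dr: "Polynomial.degree r < Polynomial.degree p"
    unfolding r_def using degree_mod_less'[of p v] p0 by fastforce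
  have "p dvd v - r" by (simp add: r_def minus_mod_eq_mult_div)
  then have "p dvd (v\<^sup>2 - [:e:]) - (v - r) * (v + r)" using less.prems(4) by simp
  also have "(v\<^sup>2 - [:e:]) - (v - r) * (v + r) = r\<^sup>2 - [:e:]"
    by (simp add: power2_eq_square algebra_simps)
  finally have "p dvd r\<^sup>2 - [:e:]" .
  then obtain s where s: "r\<^sup>2 - [:e:] = p * s" by auto
  show ?case
  proof (cases "Polynomial.degree r = 0")
    case True
    then obtain w where w: "r = [:w:]" by (metis degree_eq_zeroE)
    have "p * s = [:w\<^sup>2 - e:]" using s[symmetric] w by (simp add: power2_eq_square)
    then have "Polynomial.degree (p * s) = 0" by simp
    (* p has positive degree, so it divides a constant only if the constant is 0. *)
    then have "s = 0" using p0 degree_mult_eq[of p s] by auto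
    then have "w\<^sup>2 = e" using \<open>p * s = [:w\<^sup>2 - e:]\<close> by simp
    then show ?thesis using r w by auto
  next
    case False
    have r0: "r \<noteq> 0" using False by auto
    have sq: "Polynomial.degree (r\<^sup>2) = 2 * Polynomial.degree r"
      using r0 by (simp add: degree_power_eq)
    then have "Polynomial.degree (r\<^sup>2 + [:- e:]) = Polynomial.degree (r\<^sup>2)"
      using False by (intro degree_add_eq_left) simp
    moreover have "r\<^sup>2 + [:- e:] = p * s" unfolding s[symmetric] diff_conv_add_uminus by simp
    ultimately have d: "Polynomial.degree (p * s) = 2 * Polynomial.degree r"
      using sq by simp
    then have s0: "s \<noteq> 0" using False by auto
    then have d': "Polynomial.degree p + Polynomial.degree s = 2 * Polynomial.degree r"
      using d p0 degree_mult_eq[of p s] by simp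
    have "odd (Polynomial.degree s)" "Polynomial.degree s < Polynomial.degree p"
      using d' less.prems(2) dr by presburger+
    moreover have "poly_over K s"
    proof -
      have "s = (r\<^sup>2 - [:e:]) div p" using s p0 by simp
      moreover have "poly_over K (r\<^sup>2 - [:e:])" using r e ar by (simp add: ar)
      ultimately show ?thesis using poly_over_div_mod[OF K] less.prems by auto
    qed
    moreover have "s dvd r\<^sup>2 - [:e:]" using s by simp
    ultimately show ?thesis using less.hyps[of s r] r by blast
  qed
qed

section \<open>Real roots that are conjugate over a subfield\<close>

definition conjugate_over :: "real set \<Rightarrow> real set \<Rightarrow> bool" where
  "conjugate_over K A \<longleftrightarrow>
     (\<forall>\<alpha>\<in>A. \<forall>\<beta>\<in>A. \<forall>p. poly_over K p \<longrightarrow> poly p \<alpha> = 0 \<longrightarrow> poly p \<beta> = 0)"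

lemma conjugate_overD:
  "conjugate_over K A \<Longrightarrow> \<alpha> \<in> A \<Longrightarrow> \<beta> \<in> A \<Longrightarrow> poly_over K p \<Longrightarrow> poly p \<alpha> = 0 \<Longrightarrow> poly p \<beta> = 0"
  unfolding conjugate_over_def by blast

lemma odd_degree_has_root:
  fixes p :: "real poly"
  assumes "odd (Polynomial.degree p)"
  shows "\<exists>x. poly p x = 0"
proof -
  have pos: "\<exists>b. \<forall>x\<ge>b. poly p x > 0" if "lead_coeff p > 0" for p :: "real poly"
    using poly_pinfty_gt_lc[OF that] that by (meson less_le_trans)
  have ex: "\<exists>x. poly p x = 0" if p: "odd (Polynomial.degree p)" "lead_coeff p > 0" for p :: "real poly"
  proof -
    let ?p = "- (p \<circ>\<^sub>p [:0, -1:])"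
    have "lead_coeff ?p > 0" using p by (simp add: lead_coeff_comp)
    then obtain b where b: "\<forall>x\<ge>b. poly ?p x > 0" using pos by blast
    obtain c where c: "\<forall>x\<ge>c. poly p x > 0" using pos p by blast
    let ?x = "max 1 (max b c)"
    have "poly ?p ?x > 0" "poly p ?x > 0" "- ?x < ?x" using b c by auto
    then have "poly p (- ?x) < 0" "poly p ?x > 0" "- ?x < ?x" by (simp_all add: poly_pcompose)
    then show ?thesis using poly_IVT_pos[of "- ?x" ?x p] by blast
  qed
  show ?thesis
  proof (cases "lead_coeff p > 0")
    case False
    moreover have "p \<noteq> 0" using assms by auto
    ultimately have "lead_coeff p < 0" by (metis leading_coeff_0_iff linorder_neqE_linordered_idom)
    then have "lead_coeff (- p) > 0" by simp
    then show ?thesis using ex[of "- p"] assms by simp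
  qed (use ex assms in blast)
qed

text \<open>
  Over the higher fields of the tower \<open>f\<close> may be reducible, but its real roots are still
  conjugate, and that is enough for their minimal polynomial \<open>q\<close> to have odd degree. A divisor
  of \<open>f\<close> of odd degree has a real root, so it vanishes at \<open>\<alpha>\<close> and is divisible by
  \<open>q\<close>. If the degree of \<open>q\<close> were even, the quotient would be a smaller divisor of odd
  degree, without end.
\<close>

lemma odd_degree_minimal_poly_of_conjugate:
  assumes K: "subfield K real_ring" and conj: "conjugate_over K {x. poly f x = 0}"
    and f: "poly_over K f" "odd (Polynomial.degree f)" and a: "poly f \<alpha> = 0"
    and q: "poly_over K q" "q \<noteq> 0" "poly q \<alpha> = 0" and dvd: "\<And>p. poly_over K p \<Longrightarrow> poly p \<alpha> = 0 \<Longrightarrow> q dvd p"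
  shows "odd (Polynomial.degree q)"
proof (rule ccontr)
  assume even: "\<not> odd (Polynomial.degree q)"
  have False if "poly_over K p" "odd (Polynomial.degree p)" "p dvd f" for p
    using that
  proof (induction "Polynomial.degree p" arbitrary: p rule: less_induct)
    case less
    have p0: "p \<noteq> 0" using less.prems by auto
    obtain x where x: "poly p x = 0" using odd_degree_has_root less.prems(2) by blast
    then have "poly f x = 0" using less.prems(3) by auto
    then have "poly p \<alpha> = 0" using conjugate_overD[OF conj _ _ less.prems(1) x] a by simp
    then obtain s where s: "p = q * s" using dvd less.prems(1) by blast
    have s0: "s \<noteq> 0" using p0 s by auto
    have deg: "Polynomial.degree p = Polynomial.degree q + Polynomial.degree s"
      unfolding s using q s0 by (simp add: degree_mult_eq)
    have "poly_over K s" using poly_over_div_mod(1)[OF K less.prems(1) q(1)] s q by simp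
    moreover have "odd (Polynomial.degree s)" using deg even less.prems(2) by simp
    moreover have "s dvd f" using less.prems(3) s by (metis dvd_mult_right)
    moreover have "Polynomial.degree q \<noteq> 0"
      using q(2,3) by (metis degree_eq_zeroE poly_const_conv pCons_0_0)
    ultimately show False using less.hyps[of s] deg by simp
  qed
  from this[OF f] show False by simp
qed

text \<open>
  This holds because \<open>K\<close> has no quadratic extension inside $K[\alpha]$, whose degree over
  \<open>K\<close> is odd. In terms of polynomials, the square of $v(\alpha)$ is
  congruent to $v^2$ modulo the minimal polynomial of \<open>\<alpha>\<close>.
\<close>

lemma square_root_in_odd_extension:
  assumes K: "subfield K real_ring" and conj: "conjugate_over K {x. poly f x = 0}"
    and f: "poly_over K f" "odd (Polynomial.degree f)" and a: "poly f \<alpha> = 0"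
    and v: "poly_over K v" and sq: "(poly v \<alpha>)\<^sup>2 \<in> K"
  shows "poly v \<alpha> \<in> K"
proof -
  have f0: "f \<noteq> 0" using f by auto
  obtain q where q: "poly_over K q" "q \<noteq> 0" "poly q \<alpha> = 0"
    and dvd: "\<And>p. poly_over K p \<Longrightarrow> poly p \<alpha> = 0 \<Longrightarrow> q dvd p"
    using minimal_poly_over_exists[OF K f(1) f0 a] by metis
  have odd: "odd (Polynomial.degree q)"
    by (rule odd_degree_minimal_poly_of_conjugate[OF K conj f a q dvd])
  let ?e = "(poly v \<alpha>)\<^sup>2"
  have "q dvd v\<^sup>2 - [:?e:]"
    by (rule dvd) (use v sq poly_over_arith[OF K] in auto)
  then obtain w where w: "w \<in> K" "w\<^sup>2 = ?e"
    using square_mod_odd_degree[OF K q(1) odd v sq] by blast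
  then have "poly v \<alpha> = w \<or> poly v \<alpha> = - w" by (metis power2_eq_iff)
  then show ?thesis using w subfield_real_ring_closed(5)[OF K] by auto
qed

text \<open>
  Here the real roots matter. Conjugacy alone determines only a power of the value at \<open>\<beta>\<close>;
  if the exponent is odd, the value itself is determined, because a real number has a single real
  root of odd order. The least exponent \<open>k\<close> that brings the value into \<open>K\<close> is odd, since
  otherwise the power of order \<open>k / 2\<close> would be a square root of an element of \<open>K\<close>.
\<close>

lemma radical_values_agree:
  assumes K: "subfield K real_ring" and conj: "conjugate_over K {x. poly f x = 0}"
    and f: "poly_over K f" "odd (Polynomial.degree f)" and a: "poly f \<alpha> = 0" and b: "poly f \<beta> = 0"
    and u: "poly_over K u" and n: "(poly u \<alpha>) ^ n \<in> K" "n > 0"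
  shows "poly u \<beta> = poly u \<alpha>"
proof -
  define k where "k = (LEAST k. k > 0 \<and> (poly u \<alpha>) ^ k \<in> K)"
  have k: "k > 0 \<and> (poly u \<alpha>) ^ k \<in> K" unfolding k_def by (rule LeastI[of _ n]) (use n in auto)
  have "odd k"
  proof
    assume "even k"
    then obtain l where l: "k = 2 * l" by auto
    have "(poly u \<alpha>) ^ l \<in> K"
      using square_root_in_odd_extension[OF K conj f a poly_over_arith(6)[OF K u, of l]] k l
      by (simp add: power_mult[symmetric] mult.commute)
    then have "k \<le> l" unfolding k_def using k l by (intro Least_le) auto
    then show False using l k by simp
  qed
  have "poly (u ^ k - [:(poly u \<alpha>) ^ k:]) \<beta> = 0"
    by (rule conjugate_overD[OF conj, of \<alpha>]) (use a b u k poly_over_arith[OF K] in auto)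
  then have "(poly u \<beta>) ^ k = (poly u \<alpha>) ^ k" by simp
  then show ?thesis using \<open>odd k\<close> by (metis odd_real_root_unique)
qed

section \<open>Adjoining a radical\<close>

text \<open>
  Graph of the correspondence $\sum_{j<m} h_j(\alpha) a^j \mapsto \sum_{j<m} h_j(\beta) a^j$, which
  replaces \<open>\<alpha>\<close> by \<open>\<beta>\<close> and fixes \<open>K\<close> and \<open>a\<close>. It is a relation because the
  coefficients \<open>h j\<close> are not determined by the sum, so a function would first need a proof that
  it is well defined. What matters are its closure properties: it contains the constants and is
  stable under addition and under multiplication by \<open>a\<close> and by the pair of conjugates, which
  covers the evaluation of polynomials in Horner form.
\<close>

definition transfer_graph :: "real set \<Rightarrow> nat \<Rightarrow> real \<Rightarrow> real \<Rightarrow> real \<Rightarrow> (real \<times> real) set" where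
  "transfer_graph K m a \<alpha> \<beta> =
     {(\<Sum>j<m. poly (h j) \<alpha> * a ^ j, \<Sum>j<m. poly (h j) \<beta> * a ^ j) |h. \<forall>j. poly_over K (h j)}"

lemma transfer_graphI:
  "(\<And>j. poly_over K (h j)) \<Longrightarrow> s = (\<Sum>j<m. poly (h j) \<alpha> * a ^ j) \<Longrightarrow> t = (\<Sum>j<m. poly (h j) \<beta> * a ^ j)
   \<Longrightarrow> (s, t) \<in> transfer_graph K m a \<alpha> \<beta>"
  unfolding transfer_graph_def by blast

lemma transfer_graphE:
  assumes "(s, t) \<in> transfer_graph K m a \<alpha> \<beta>"
  obtains h where "\<And>j. poly_over K (h j)" "s = (\<Sum>j<m. poly (h j) \<alpha> * a ^ j)"
    "t = (\<Sum>j<m. poly (h j) \<beta> * a ^ j)"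
  using assms unfolding transfer_graph_def by blast

lemma transfer_graph_add:
  assumes K: "subfield K real_ring"
    and "(s, t) \<in> transfer_graph K m a \<alpha> \<beta>" "(s', t') \<in> transfer_graph K m a \<alpha> \<beta>"
  shows "(s + s', t + t') \<in> transfer_graph K m a \<alpha> \<beta>"
  using assms(2)
proof (rule transfer_graphE)
  fix h assume h: "\<And>j. poly_over K (h j)" "s = (\<Sum>j<m. poly (h j) \<alpha> * a ^ j)" "t = (\<Sum>j<m. poly (h j) \<beta> * a ^ j)"
  obtain h' where h': "\<And>j. poly_over K (h' j)" "s' = (\<Sum>j<m. poly (h' j) \<alpha> * a ^ j)" "t' = (\<Sum>j<m. poly (h' j) \<beta> * a ^ j)"
    using assms(3) by (elim transfer_graphE) blast
  show ?thesis
    by (rule transfer_graphI[of K "\<lambda>j. h j + h' j"])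
       (use h h' poly_over_arith[OF K] in \<open>auto simp: sum.distrib algebra_simps\<close>)
qed

lemma transfer_graph_const:
  assumes K: "subfield K real_ring" and "m > 0" "e \<in> K"
  shows "(e, e) \<in> transfer_graph K m a \<alpha> \<beta>"
proof -
  let ?h = "\<lambda>j. if j = 0 then [:e:] else 0"
  have "(\<Sum>j<m. poly (?h j) x * a ^ j) = (\<Sum>j<m. if j = 0 then e else 0)" for x
    by (rule sum.cong) auto
  then have "e = (\<Sum>j<m. poly (?h j) x * a ^ j)" for x
    using assms(2) by simp
  then show ?thesis
    using assms(3) poly_over_arith(1)[OF K] by (intro transfer_graphI[of K ?h]) auto
qed

lemma transfer_graph_mult_conjugate:
  assumes K: "subfield K real_ring" and "(s, t) \<in> transfer_graph K m a \<alpha> \<beta>"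
  shows "(\<alpha> * s, \<beta> * t) \<in> transfer_graph K m a \<alpha> \<beta>"
  using assms(2)
proof (rule transfer_graphE)
  fix h assume h: "\<And>j. poly_over K (h j)" "s = (\<Sum>j<m. poly (h j) \<alpha> * a ^ j)" "t = (\<Sum>j<m. poly (h j) \<beta> * a ^ j)"
  show ?thesis
    by (rule transfer_graphI[of K "\<lambda>j. pCons 0 (h j)"])
       (use h subfield_real_ring_closed(1)[OF K] in \<open>auto simp: sum_distrib_left mult.assoc\<close>)
qed

text \<open>
  Multiplication by \<open>a\<close> shifts the coefficients by one place. The top term wraps around by
  $a^m = u(\alpha)$ on one side and by $a^m = u(\beta)$ on the other. This is the only
  place where the two values of \<open>u\<close> have to agree.
\<close>

lemma transfer_graph_mult_radical:
  assumes K: "subfield K real_ring" and m: "m > 0" and u: "poly_over K u" "poly u \<alpha> = a ^ m" "poly u \<beta> = a ^ m"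
    and "(s, t) \<in> transfer_graph K m a \<alpha> \<beta>"
  shows "(a * s, a * t) \<in> transfer_graph K m a \<alpha> \<beta>"
  using assms(6)
proof (rule transfer_graphE)
  fix h assume h: "\<And>j. poly_over K (h j)" "s = (\<Sum>j<m. poly (h j) \<alpha> * a ^ j)" "t = (\<Sum>j<m. poly (h j) \<beta> * a ^ j)"
  obtain m' where m': "m = Suc m'" using m by (cases m) auto
  define h' where "h' j = (if j = 0 then u * h m' else h (j - 1))" for j
  have shift: "a * (\<Sum>j<m. poly (h j) x * a ^ j) = (\<Sum>j<m. poly (h' j) x * a ^ j)"
    if "poly u x = a ^ m" for x
  proof -
    have "(\<Sum>j<m. poly (h' j) x * a ^ j) = poly (u * h m') x + (\<Sum>j<m'. poly (h j) x * a ^ Suc j)"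
      unfolding m' sum.lessThan_Suc_shift by (simp add: h'_def)
    also have "\<dots> = a * (\<Sum>j<m. poly (h j) x * a ^ j)"
      unfolding m' using that by (simp add: m' sum_distrib_left algebra_simps)
    finally show ?thesis by simp
  qed
  show ?thesis
    by (rule transfer_graphI[of K h'])
       (use h u shift poly_over_arith(5)[OF K] in \<open>auto simp: h'_def[abs_def]\<close>)
qed

text \<open>
  The pair $(p(\alpha), p(\beta))$ lies in the graph for every \<open>p\<close> over $K[a]$. If
  $p(\alpha) = 0$, independence of the powers of \<open>a\<close> over $K[\alpha]$ makes every coefficient
  $h_j(\alpha)$ vanish, and conjugacy over \<open>K\<close> carries this over to \<open>\<beta>\<close>.
\<close>

lemma conjugate_over_radical_step:
  assumes K: "subfield K real_ring" and conj: "conjugate_over K {x. poly f x = 0}"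
    and f: "poly_over K f" "odd (Polynomial.degree f)"
    and Ka: "\<And>\<alpha>. poly f \<alpha> = 0 \<Longrightarrow> subfield (ring.simple_extension real_ring K \<alpha>) real_ring"
    and n: "a ^ n \<in> K" "n > 0"
  shows "conjugate_over (ring.simple_extension real_ring K a) {x. poly f x = 0}"
  unfolding conjugate_over_def mem_Collect_eq
proof (intro ballI allI impI, unfold mem_Collect_eq)
  fix \<alpha> \<beta> p
  assume a: "poly f \<alpha> = 0" and b: "poly f \<beta> = 0"
    and p: "poly_over (ring.simple_extension real_ring K a) p" and pa: "poly p \<alpha> = 0"
  define L where "L = ring.simple_extension real_ring K \<alpha>"
  have L: "L = {poly p \<alpha> |p. poly_over K p}" "subfield L real_ring"
    unfolding L_def using simple_extension_eq_poly_values[OF K] Ka a by auto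
  have "K \<subseteq> L"
  proof
    fix x assume "x \<in> K"
    then show "x \<in> L" unfolding L using poly_over_arith(1)[OF K] by (auto intro!: exI[of _ "[:x:]"])
  qed
  define m where "m = (LEAST m. m > 0 \<and> a ^ m \<in> L)"
  have m: "m > 0 \<and> a ^ m \<in> L" unfolding m_def by (rule LeastI[of _ n]) (use n \<open>K \<subseteq> L\<close> in auto)
  have min: "a ^ j \<notin> L" if "0 < j" "j < m" for j
    using not_less_Least[of j "\<lambda>m. m > 0 \<and> a ^ m \<in> L"] that unfolding m_def by auto
  obtain u where u: "poly_over K u" "poly u \<alpha> = a ^ m" using m L(1) by force
  (* The n-th power of a^m is the m-th power of a^n. *)
  have "(poly u \<alpha>) ^ n \<in> K"
    using subfield_real_ring_closed(8)[OF K n(1), of m] u(2)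
    by (simp add: power_mult[symmetric] mult.commute)
  then have ub: "poly u \<beta> = a ^ m"
    using radical_values_agree[OF K conj f a b u(1) _ n(2)] u(2) by simp
  let ?G = "transfer_graph K m a \<alpha> \<beta>"
  have coeffs: "(poly c a, poly c a) \<in> ?G" if "poly_over K c" for c
    using that
  proof (induction c)
    case 0
    then show ?case using transfer_graph_const[OF K, of m 0] m subfield_real_ring_closed(1)[OF K] by simp
  next
    case (pCons e c)
    then have "(a * poly c a, a * poly c a) \<in> ?G" "(e, e) \<in> ?G"
      using transfer_graph_mult_radical[OF K _ u ub] transfer_graph_const[OF K] m by auto
    from transfer_graph_add[OF K this(2,1)] show ?case by simp
  qed
  have "(poly p \<alpha>, poly p \<beta>) \<in> ?G"
    using p
  proof (induction p)
    case 0
    then show ?case using transfer_graph_const[OF K, of m 0] m subfield_real_ring_closed(1)[OF K] by simp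
  next
    case (pCons e p)
    then obtain c where "poly_over K c" "e = poly c a"
      unfolding simple_extension_eq_poly_values[OF K] by auto
    then have "(e, e) \<in> ?G" using coeffs by simp
    moreover have "(\<alpha> * poly p \<alpha>, \<beta> * poly p \<beta>) \<in> ?G"
      by (rule transfer_graph_mult_conjugate[OF K]) (use pCons in auto)
    ultimately show ?case using transfer_graph_add[OF K] by fastforce
  qed
  then obtain h where h: "\<And>j. poly_over K (h j)" "0 = (\<Sum>j<m. poly (h j) \<alpha> * a ^ j)"
      "poly p \<beta> = (\<Sum>j<m. poly (h j) \<beta> * a ^ j)"
    unfolding pa by (elim transfer_graphE) blast
  let ?r = "\<Sum>j<m. Polynomial.monom (poly (h j) \<alpha>) j"
  have cr: "Polynomial.coeff ?r i = (if i < m then poly (h i) \<alpha> else 0)" for i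
    by (simp add: coeff_sum)
  have "?r = 0"
  proof (rule radical_powers_independent[OF L(2), of a m])
    show "poly_over L ?r"
      unfolding poly_over_def cr using h(1) L subfield_real_ring_closed(1)[OF L(2)] by auto
    show "Polynomial.degree ?r < m" using m cr by (intro degree_lessI) auto
    show "poly ?r a = 0" using h(2) by (simp add: poly_sum poly_monom)
  qed (use m min in auto)
  then have "poly (h j) \<alpha> = 0" if "j < m" for j using cr[of j] that by simp
  then have "poly (h j) \<beta> = 0" if "j < m" for j
    using conjugate_overD[OF conj _ _ h(1)] a b that by blast
  then show "poly p \<beta> = 0" using h(3) by simp
qed

section \<open>From list polynomials over a subfield to real polynomials\<close>

text \<open>
  List polynomials start with the leading coefficient, type-level polynomials with the constant
  term; this explains the reversals below.
\<close>

lemma eval_real_ring: "ring.eval real_ring xs x = poly (Poly (rev xs)) x"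
proof -
  interpret R: field real_ring by (rule field_real_ring)
  show ?thesis
    by (induction xs) (simp_all add: Poly_append poly_monom)
qed

lemma poly_over_Poly_rev:
  assumes "subfield K real_ring" "xs \<in> carrier (K [X]\<^bsub>real_ring\<^esub>)"
  shows "poly_over K (Poly (rev xs))"
proof -
  have "set xs \<subseteq> K" using assms(2) by (auto simp: univ_poly_def polynomial_def)
  then show ?thesis
    using subfield_real_ring_closed(1)[OF assms(1)]
    by (auto simp: poly_over_def nth_default_def) (metis length_rev nth_mem set_rev subsetD)
qed

lemma degree_Poly_rev:
  assumes "xs \<in> carrier (K [X]\<^bsub>real_ring\<^esub>)"
  shows "Polynomial.degree (Poly (rev xs)) = Polynomials.degree xs"
proof (cases xs)
  case (Cons x ys)
  then have "x \<noteq> 0" using assms by (auto simp: univ_poly_def polynomial_def)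
  then have "coeffs (Poly (rev xs)) = rev xs" by (simp add: Cons)
  then show ?thesis by (metis degree_eq_length_coeffs length_rev)
qed simp

lemma carrier_of_poly_over:
  assumes "poly_over K p"
  shows "rev (coeffs p) \<in> carrier (K [X]\<^bsub>real_ring\<^esub>)"
proof (cases "p = 0")
  case False
  then have "hd (rev (coeffs p)) \<noteq> 0"
    by (simp add: hd_rev last_coeffs_eq_coeff_degree)
  moreover have "set (coeffs p) \<subseteq> K" using assms by (auto simp: coeffs_def poly_over_def)
  ultimately show ?thesis by (auto simp: univ_poly_def polynomial_def)
qed (simp add: univ_poly_def polynomial_def)

text \<open>
  An irreducible polynomial with the root \<open>\<alpha>\<close> is associated to the minimal polynomial of
  \<open>\<alpha>\<close>, so it generates the ideal of all polynomials over \<open>K\<close> that vanish at \<open>\<alpha>\<close>.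
\<close>

lemma conjugate_over_roots_pirreducible:
  assumes K: "subfield K real_ring" and f: "f \<in> carrier (K [X]\<^bsub>real_ring\<^esub>)" "pirreducible\<^bsub>real_ring\<^esub> K f"
  shows "conjugate_over K {x. poly (Poly (rev f)) x = 0}"
  unfolding conjugate_over_def
proof (intro ballI allI impI, unfold mem_Collect_eq)
  fix \<alpha> \<beta> p
  assume a: "poly (Poly (rev f)) \<alpha> = 0" and b: "poly (Poly (rev f)) \<beta> = 0"
    and p: "poly_over K p" and pa: "poly p \<alpha> = 0"
  interpret R: field real_ring by (rule field_real_ring)
  interpret UP: principal_domain "K [X]\<^bsub>real_ring\<^esub>" using R.univ_poly_is_principal[OF K] .
  have car: "x \<in> carrier real_ring" for x by simp
  have z: "\<zero>\<^bsub>real_ring\<^esub> = 0" by simp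
  have f0: "f \<noteq> []" using f(2) by (auto simp: ring_irreducible_def univ_poly_zero)
  have fa: "R.eval f \<alpha> = \<zero>\<^bsub>real_ring\<^esub>" "R.eval f \<beta> = \<zero>\<^bsub>real_ring\<^esub>"
    using a b z by (simp_all add: eval_real_ring)
  have alg: "(R.algebraic over K) \<alpha>" by (rule R.algebraicI[OF f(1) f0 fa(1)])
  have I: "R.Irr K \<alpha> \<in> carrier (K [X]\<^bsub>real_ring\<^esub>)" "pirreducible\<^bsub>real_ring\<^esub> K (R.Irr K \<alpha>)"
    using R.IrrE[OF K car alg] by auto
  note ker = R.Irr_generates_ker[OF K car alg]
  have "f \<in> PIdl\<^bsub>K [X]\<^bsub>real_ring\<^esub>\<^esub> (R.Irr K \<alpha>)"
    unfolding ker[symmetric] a_kernel_def' using f fa by auto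
  then have "R.Irr K \<alpha> \<sim>\<^bsub>K [X]\<^bsub>real_ring\<^esub>\<^esub> f"
    using R.cgenideal_pirreducible[OF K I f(2)] by simp
  then have PI: "PIdl\<^bsub>K [X]\<^bsub>real_ring\<^esub>\<^esub> (R.Irr K \<alpha>) = PIdl\<^bsub>K [X]\<^bsub>real_ring\<^esub>\<^esub> f"
    using UP.associated_iff_same_ideal I f by auto
  let ?p = "rev (coeffs p)"
  have "R.eval ?p \<alpha> = \<zero>\<^bsub>real_ring\<^esub>" using pa z by (simp add: eval_real_ring)
  then have "?p \<in> PIdl\<^bsub>K [X]\<^bsub>real_ring\<^esub>\<^esub> f"
    unfolding PI[symmetric] ker[symmetric] a_kernel_def' using carrier_of_poly_over[OF p] by auto
  then obtain g where g: "g \<in> carrier (K [X]\<^bsub>real_ring\<^esub>)" "?p = g \<otimes>\<^bsub>K [X]\<^bsub>real_ring\<^esub>\<^esub> f"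
    unfolding cgenideal_def by auto
  have "R.eval ?p \<beta> = R.eval g \<beta> \<otimes>\<^bsub>real_ring\<^esub> R.eval f \<beta>"
    unfolding g(2) using ring_hom_memE(2)[OF R.eval_is_hom[OF subfieldE(1)[OF K] car] g(1) f(1)] .
  then show "poly p \<beta> = 0" unfolding fa(2) z by (simp add: eval_real_ring)
qed

lemma subfield_simple_extension_root:
  assumes K: "subfield K real_ring" and p: "poly_over K p" "p \<noteq> 0" "poly p a = 0"
  shows "subfield (ring.simple_extension real_ring K a) real_ring"
proof -
  interpret R: field real_ring by (rule field_real_ring)
  have car: "a \<in> carrier real_ring" by simp
  have "(R.algebraic over K) a"
    by (rule R.algebraicI[OF carrier_of_poly_over[OF p(1)]])
       (use p in \<open>simp_all add: eval_real_ring\<close>)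
  then show ?thesis using R.simple_extension_is_subfield[OF K car] by blast
qed

section \<open>The only real root\<close>

theorem theoremC:
  fixes Q L :: "real set" and f :: "real list" and \<alpha> :: real
  assumes "subfield Q real_ring"
    and "f \<in> carrier (Q [X]\<^bsub>real_ring\<^esub>)"
    and "pirreducible\<^bsub>real_ring\<^esub> Q f"
    and "odd (Polynomials.degree f)"
    and "ring.repeated_radical_extension real_ring Q L"
    and "\<alpha> \<in> L"
    and "ring.is_root real_ring f \<alpha>"
  shows "{x. ring.is_root real_ring f x} = {\<alpha>}"
proof -
  interpret R: field real_ring by (rule field_real_ring)
  let ?f = "Poly (rev f)" and ?A = "{x. poly (Poly (rev f)) x = 0}"
  have roots: "R.is_root f x \<longleftrightarrow> poly ?f x = 0" for x
    using assms(4) by (auto simp: R.is_root_def eval_real_ring)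
  have f: "poly_over Q ?f" "odd (Polynomial.degree ?f)"
    using poly_over_Poly_rev[OF assms(1,2)] degree_Poly_rev[OF assms(2)] assms(4) by auto
  obtain r :: nat and E :: "nat \<Rightarrow> real set" where "E 0 = Q \<and> E r = L \<and> (\<forall>i\<le>r. subfield (E i) real_ring) \<and>
      (\<forall>i. 0 < i \<and> i \<le> r \<longrightarrow> R.radical_extension (E (i - 1)) (E i))"
    using assms(5) unfolding R.repeated_radical_extension_def by blast
  then have E: "E 0 = Q" "E r = L" "\<And>i. i \<le> r \<Longrightarrow> subfield (E i) real_ring"
    "\<And>i. 0 < i \<Longrightarrow> i \<le> r \<Longrightarrow> R.radical_extension (E (i - 1)) (E i)"
    by blast+
  have "conjugate_over (E i) ?A \<and> poly_over (E i) ?f" if "i \<le> r" for i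
    using that
  proof (induction i)
    case 0
    show ?case using conjugate_over_roots_pirreducible[OF assms(1-3)] f E(1) by simp
  next
    case (Suc i)
    then have IH: "conjugate_over (E i) ?A" "poly_over (E i) ?f" and sub: "subfield (E i) real_ring"
      using E(3) by auto
    have "R.radical_extension (E i) (E (Suc i))" using E(4)[of "Suc i"] Suc.prems by simp
    then obtain a n where a: "E i \<subseteq> E (Suc i)" "E (Suc i) = R.simple_extension (E i) a" "n > 0" "a ^ n \<in> E i"
      unfolding R.radical_extension_def real_ring_power by blast
    have "conjugate_over (E (Suc i)) ?A"
      unfolding a(2)
    proof (rule conjugate_over_radical_step[OF sub IH f(2) _ a(4,3)])
      show "subfield (R.simple_extension (E i) x) real_ring" if "poly ?f x = 0" for x
        by (rule subfield_simple_extension_root[OF sub IH(2) _ that]) (use f(2) in auto)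
    qed
    then show ?case using poly_over_mono[OF IH(2) a(1)] by simp
  qed
  from this[of r] have conj: "conjugate_over L ?A" using E(2) by simp
  have L: "subfield L real_ring" using E(2,3) by auto
  have a: "poly ?f \<alpha> = 0" using assms(7) roots by simp
  have "\<beta> = \<alpha>" if "poly ?f \<beta> = 0" for \<beta>
  proof -
    have lin: "poly_over L [:- \<alpha>, 1:]"
      using subfield_real_ring_closed(2)[OF L] subfield_real_ring_closed(5)[OF L assms(6)]
        poly_over_arith(1)[OF L] by simp
    have "poly [:- \<alpha>, 1:] \<beta> = 0"
      using conjugate_overD[OF conj _ _ lin, of \<alpha> \<beta>] a that by simp
    then show ?thesis by simp
  qed
  then show ?thesis unfolding roots using a by blast
qed

end
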